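(* Let $\lambda_1,\lambda_2,\lambda_3\in\mathbb{R}$, let $\mathbb{K}$ be the associated algebra of 3-parameter generalized quaternions, and let $v\in S^2_{\mathbb{K}}$. Then for every $\theta\in\mathbb{R}$, $$e^{v\theta}=\cos\theta+v\sin\theta,$$ where $e^{v\theta}=\sum_{k\ge0}\frac{v^k\theta^k}{k!}$.
   Context: Given $\lambda_1,\lambda_2,\lambda_3\in\mathbb{R}$, $\mathbb{K}$ is the (associative, unital) real algebra with vector-space basis $1,e_1,e_2,e_3$, unit $1$, and bilinear multiplication determined by $e_1^2=-\lambda_1\lambda_2$, $e_2^2=-\lambda_1\lambda_3$, $e_3^2=-\lambda_2\lambda_3$, $e_1e_2=\lambda_1e_3=-e_2e_1$, $e_2e_3=\lambda_3e_1=-e_3e_2$, $e_3e_1=\lambda_2e_2=-e_1e_3$. For $p=a_0+a_1e_1+a_2e_2+a_3e_3\in\mathbb{K}$ (with $a_i\in\mathbb{R}$), the norm is $N_p=a_0^2+\lambda_1\lambda_2a_1^2+\lambda_1\lambda_3a_2^2+\lambda_2\lambda_3a_3^2$. $\mathrm{Im}(\mathbb{K})=\{a_1e_1+a_2e_2+a_3e_3:a_i\in\mathbb{R}\}$ and $S^2_{\mathbb{K}}=\{h\in\mathrm{Im}(\mathbb{K}):N_h=1\}$. The exponential series converges in the usual topology of $\mathbb{K}\cong\mathbb{R}^4$. *)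

theory Defs
  imports "HOL-Analysis.Analysis"
begin

(* The algebra depends on the real parameters l1, l2, l3, so it is not a type class instance:
   its underlying space is real^4, whose index type 4 has the elements 0, 1, 2, 3, and only the
   multiplication takes the parameters. The coordinate of 1 is p $ 0. *)

type_synonym gquat = "real ^ 4"

definition gq_e :: "4 \<Rightarrow> gquat" where
  "gq_e i = axis i 1"

definition gq_one :: gquat where
  "gq_one = gq_e 0"

definition gq_basis_prod :: "real \<Rightarrow> real \<Rightarrow> real \<Rightarrow> 4 \<Rightarrow> 4 \<Rightarrow> gquat" where
  "gq_basis_prod l1 l2 l3 i j =
    (if i = 0 then gq_e j
     else if j = 0 then gq_e i
     else if (i, j) = (1, 1) then - (l1 * l2) *\<^sub>R gq_one
     else if (i, j) = (2, 2) then - (l1 * l3) *\<^sub>R gq_one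
     else if (i, j) = (3, 3) then - (l2 * l3) *\<^sub>R gq_one
     else if (i, j) = (1, 2) then l1 *\<^sub>R gq_e 3
     else if (i, j) = (2, 1) then - l1 *\<^sub>R gq_e 3
     else if (i, j) = (2, 3) then l3 *\<^sub>R gq_e 1
     else if (i, j) = (3, 2) then - l3 *\<^sub>R gq_e 1
     else if (i, j) = (3, 1) then l2 *\<^sub>R gq_e 2
     else - l2 *\<^sub>R gq_e 2)"

definition gq_mult :: "real \<Rightarrow> real \<Rightarrow> real \<Rightarrow> gquat \<Rightarrow> gquat \<Rightarrow> gquat" where
  "gq_mult l1 l2 l3 p q =
    (\<Sum>i\<in>UNIV. \<Sum>j\<in>UNIV. (p $ i * q $ j) *\<^sub>R gq_basis_prod l1 l2 l3 i j)"

primrec gq_power :: "real \<Rightarrow> real \<Rightarrow> real \<Rightarrow> gquat \<Rightarrow> nat \<Rightarrow> gquat" where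
  "gq_power l1 l2 l3 p 0 = gq_one"
| "gq_power l1 l2 l3 p (Suc k) = gq_mult l1 l2 l3 p (gq_power l1 l2 l3 p k)"

definition gq_exp :: "real \<Rightarrow> real \<Rightarrow> real \<Rightarrow> gquat \<Rightarrow> gquat" where
  "gq_exp l1 l2 l3 p = (\<Sum>k. (1 / fact k) *\<^sub>R gq_power l1 l2 l3 p k)"

definition gq_norm :: "real \<Rightarrow> real \<Rightarrow> real \<Rightarrow> gquat \<Rightarrow> real" where
  "gq_norm l1 l2 l3 p =
    (p $ 0)\<^sup>2 + l1 * l2 * (p $ 1)\<^sup>2 + l1 * l3 * (p $ 2)\<^sup>2 + l2 * l3 * (p $ 3)\<^sup>2"

definition gq_Im :: "gquat set" where
  "gq_Im = {a1 *\<^sub>R gq_e 1 + a2 *\<^sub>R gq_e 2 + a3 *\<^sub>R gq_e 3 | a1 a2 a3. True}"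

definition gq_sphere :: "real \<Rightarrow> real \<Rightarrow> real \<Rightarrow> gquat set" where
  "gq_sphere l1 l2 l3 = {h \<in> gq_Im. gq_norm l1 l2 l3 h = 1}"

lemma UNIV_4_from_0: "(UNIV :: 4 set) = {0, 1, 2, 3}"
proof -
  have "(4::4) = 0" by simp
  then show ?thesis unfolding UNIV_4 by auto
qed

lemma sum_UNIV_4_from_0:
  "sum f (UNIV :: 4 set) = f 0 + (f 1 + (f 2 + (f 3 :: 'a::comm_monoid_add)))"
  unfolding UNIV_4_from_0 by simp

lemma all_4_from_0: "(\<forall>i::4. P i) \<longleftrightarrow> P 0 \<and> P 1 \<and> P 2 \<and> P 3"
proof -
  have "(\<forall>i::4. P i) \<longleftrightarrow> (\<forall>i\<in>UNIV. P i)" by simp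
  then show ?thesis unfolding UNIV_4_from_0 by simp
qed

lemma gq_eq_iff:
  "(p :: gquat) = q \<longleftrightarrow> p $ 0 = q $ 0 \<and> p $ 1 = q $ 1 \<and> p $ 2 = q $ 2 \<and> p $ 3 = q $ 3"
  unfolding vec_eq_iff all_4_from_0 ..

lemma gq_e_nth: "gq_e i $ j = (if j = i then 1 else 0)"
  by (simp add: gq_e_def axis_def)

lemma gq_mult_nth:
  fixes p q :: gquat
  shows
  "gq_mult l1 l2 l3 p q $ 0 = p$0 * q$0 - l1*l2 * p$1 * q$1 - l1*l3 * p$2 * q$2 - l2*l3 * p$3 * q$3"
  "gq_mult l1 l2 l3 p q $ 1 = p$0 * q$1 + p$1 * q$0 + l3 * (p$2 * q$3 - p$3 * q$2)"
  "gq_mult l1 l2 l3 p q $ 2 = p$0 * q$2 + p$2 * q$0 + l2 * (p$3 * q$1 - p$1 * q$3)"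
  "gq_mult l1 l2 l3 p q $ 3 = p$0 * q$3 + p$3 * q$0 + l1 * (p$1 * q$2 - p$2 * q$1)"
  unfolding gq_mult_def sum_UNIV_4_from_0
  by (simp_all add: gq_basis_prod_def gq_one_def gq_e_nth)
    (simp_all add: algebra_simps)

lemma gq_mult_basis: "gq_mult l1 l2 l3 (gq_e i) (gq_e j) = gq_basis_prod l1 l2 l3 i j"
proof -
  have pick: "((if b then 1 else 0) * (if c then 1 else 0)) *\<^sub>R x = (if b then if c then x else 0 else 0)"
    for b c and x :: gquat by simp
  have "(\<Sum>j'\<in>UNIV. if i' = i then if j' = j then gq_basis_prod l1 l2 l3 i' j' else 0 else 0)
      = (if i' = i then gq_basis_prod l1 l2 l3 i' j else 0)" for i' by simp
  then show ?thesis unfolding gq_mult_def gq_e_nth pick by simp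
qed

lemma gq_mult_one_left: "gq_mult l1 l2 l3 gq_one p = p"
  and gq_mult_one_right: "gq_mult l1 l2 l3 p gq_one = p"
  by (simp_all add: gq_eq_iff gq_mult_nth gq_one_def gq_e_nth)

lemma gq_mult_assoc:
  "gq_mult l1 l2 l3 (gq_mult l1 l2 l3 p q) r = gq_mult l1 l2 l3 p (gq_mult l1 l2 l3 q r)"
  by (simp add: gq_eq_iff gq_mult_nth algebra_simps)

lemma bilinear_gq_mult: "bilinear (gq_mult l1 l2 l3)"
  unfolding bilinear_def
  by (auto intro!: linearI simp: gq_eq_iff gq_mult_nth algebra_simps)

lemma gq_power_scaleR: "gq_power l1 l2 l3 (t *\<^sub>R p) k = t ^ k *\<^sub>R gq_power l1 l2 l3 p k"
  by (induction k)
    (simp_all add: bilinear_lmul[OF bilinear_gq_mult] bilinear_rmul[OF bilinear_gq_mult])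

lemma gq_exp_sums: "(\<lambda>k. (1 / fact k) *\<^sub>R gq_power l1 l2 l3 p k) sums gq_exp l1 l2 l3 p"
proof -
  obtain B where B: "B > 0" "\<And>x y. norm (gq_mult l1 l2 l3 x y) \<le> B * norm x * norm y"
    using bilinear_bounded_pos[OF bilinear_gq_mult] by blast
  have bound: "norm (gq_power l1 l2 l3 p k) \<le> norm gq_one * (B * norm p) ^ k" for k
  proof (induction k)
    case (Suc k)
    have "norm (gq_power l1 l2 l3 p (Suc k)) \<le> B * norm p * norm (gq_power l1 l2 l3 p k)"
      using B(2) by simp
    also have "\<dots> \<le> B * norm p * (norm gq_one * (B * norm p) ^ k)"
      using Suc B(1) by (intro mult_left_mono) auto
    finally show ?case by (simp add: mult_ac)
  qed simp
  have "summable (\<lambda>k. norm gq_one * (inverse (fact k) * (B * norm p) ^ k))"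
    by (intro summable_mult summable_exp)
  then have "summable (\<lambda>k. (1 / fact k) *\<^sub>R gq_power l1 l2 l3 p k)"
  proof (rule summable_comparison_test'[where N = 0])
    fix k
    have "norm ((1 / fact k) *\<^sub>R gq_power l1 l2 l3 p k)
        = inverse (fact k) * norm (gq_power l1 l2 l3 p k)"
      by (simp add: divide_inverse)
    also have "\<dots> \<le> inverse (fact k) * (norm gq_one * (B * norm p) ^ k)"
      using bound by (intro mult_left_mono) auto
    finally show "norm ((1 / fact k) *\<^sub>R gq_power l1 l2 l3 p k)
        \<le> norm gq_one * (inverse (fact k) * (B * norm p) ^ k)"
      by (simp add: mult_ac)
  qed
  then show ?thesis unfolding gq_exp_def by (rule summable_sums)
qed

lemma gq_exp_scaleR:
  "gq_exp l1 l2 l3 (t *\<^sub>R p) = (\<Sum>k. (t ^ k / fact k) *\<^sub>R gq_power l1 l2 l3 p k)"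
  by (simp add: gq_exp_def gq_power_scaleR)

end

theory Submission imports Defs begin

text \<open>
  A point \<open>v\<close> of the unit sphere is imaginary, so the products of distinct basis elements cancel
  in pairs and \<open>v\<^sup>2 = -N\<^sub>v = -1\<close> (\<open>gq_mult_self_sphere\<close>). Hence \<open>v\<close> behaves as the imaginary unit:
  the span of \<open>1\<close> and \<open>v\<close> is a copy of the complex numbers, whatever the signs of the parameters,
  and Euler's formula holds there. Concretely, \<open>v\<^sup>k / k!\<close> is the sum of the coefficients of degree
  \<open>k\<close> in the Maclaurin series of \<open>cos\<close> and \<open>sin\<close>, attached to \<open>1\<close> and \<open>v\<close> respectively
  (\<open>gq_power_sphere\<close>), so the exponential series splits into these two scalar series.
\<close>

lemma gq_mult_self_sphere:
  assumes "v \<in> gq_sphere l1 l2 l3"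
  shows "gq_mult l1 l2 l3 v v = - gq_one"
proof -
  have "v $ 0 = 0" "gq_norm l1 l2 l3 v = 1"
    using assms by (auto simp: gq_sphere_def gq_Im_def gq_e_nth)
  then show ?thesis
    by (simp add: gq_eq_iff gq_mult_nth gq_one_def gq_e_nth gq_norm_def power2_eq_square algebra_simps)
qed

text \<open>
  Left multiplication by \<open>v\<close> sends \<open>a + b v\<close> to \<open>-b + a v\<close>. The Maclaurin coefficients obey the
  same recursion, because \<open>sin\<close> is an antiderivative of \<open>cos\<close> and \<open>cos\<close> of \<open>- sin\<close>; this avoids
  a case distinction on \<open>k\<close> modulo 4.
\<close>
lemma gq_power_sphere:
  assumes "v \<in> gq_sphere l1 l2 l3"
  shows "(1 / fact k) *\<^sub>R gq_power l1 l2 l3 v k = cos_coeff k *\<^sub>R gq_one + sin_coeff k *\<^sub>R v"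
proof (induction k)
  case 0
  then show ?case by simp
next
  case (Suc k)
  have "(1 / fact (Suc k)) *\<^sub>R gq_power l1 l2 l3 v (Suc k)
      = (1 / Suc k) *\<^sub>R gq_mult l1 l2 l3 v ((1 / fact k) *\<^sub>R gq_power l1 l2 l3 v k)"
    by (simp add: bilinear_rmul[OF bilinear_gq_mult])
  also have "\<dots> = (1 / Suc k) *\<^sub>R (cos_coeff k *\<^sub>R v - sin_coeff k *\<^sub>R gq_one)"
    unfolding Suc
    by (simp add: bilinear_radd[OF bilinear_gq_mult] bilinear_rmul[OF bilinear_gq_mult]
        gq_mult_one_right gq_mult_self_sphere[OF assms])
  also have "\<dots> = cos_coeff (Suc k) *\<^sub>R gq_one + sin_coeff (Suc k) *\<^sub>R v"
    by (simp add: cos_coeff_Suc sin_coeff_Suc scaleR_diff_right del: of_nat_Suc)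
  finally show ?case .
qed

theorem mainTheorem3:
  fixes l1 l2 l3 \<theta> :: real and v :: gquat
  assumes "v \<in> gq_sphere l1 l2 l3"
  shows "gq_exp l1 l2 l3 (\<theta> *\<^sub>R v) = cos \<theta> *\<^sub>R gq_one + sin \<theta> *\<^sub>R v"
proof -
  have "(1 / fact k) *\<^sub>R gq_power l1 l2 l3 (\<theta> *\<^sub>R v) k
      = (cos_coeff k *\<^sub>R \<theta> ^ k) *\<^sub>R gq_one + (sin_coeff k *\<^sub>R \<theta> ^ k) *\<^sub>R v" for k
  proof -
    have "(1 / fact k) *\<^sub>R gq_power l1 l2 l3 (\<theta> *\<^sub>R v) k
        = \<theta> ^ k *\<^sub>R ((1 / fact k) *\<^sub>R gq_power l1 l2 l3 v k)"
      by (simp add: gq_power_scaleR)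
    then show ?thesis
      unfolding gq_power_sphere[OF assms] by (simp add: scaleR_add_right mult.commute)
  qed
  moreover have "(\<lambda>k. (cos_coeff k *\<^sub>R \<theta> ^ k) *\<^sub>R gq_one + (sin_coeff k *\<^sub>R \<theta> ^ k) *\<^sub>R v)
      sums (cos \<theta> *\<^sub>R gq_one + sin \<theta> *\<^sub>R v)"
    by (intro sums_add sums_scaleR_left cos_converges sin_converges)
  ultimately show ?thesis
    unfolding gq_exp_def by (simp add: sums_iff)
qed

end
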